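(* The inclusion functor $i\colon s\mathbb{MV}\hookrightarrow\mathbb{MV}$ of the full subcategory of semisimple MV-algebras is right adjoint to the functor $S\colon\mathbb{MV}\to s\mathbb{MV}$ given by $S(A)=A/\mathrm{Rad}(A)$.
   Context: An MV-algebra is a set $A$ with a binary operation $\oplus$, a unary operation $\lnot$ and a constant $0$ such that $\oplus$ is associative and commutative, $x\oplus 0=x$, $\lnot\lnot x=x$, $x\oplus\lnot 0=\lnot 0$, and $\lnot(\lnot x\oplus y)\oplus y=\lnot(\lnot y\oplus x)\oplus x$. Morphisms are the maps preserving $\oplus,\lnot,0$; $\mathbb{MV}$ is the resulting category. Put $1=\lnot 0$, $x\ominus y=\lnot(\lnot x\oplus y)$, $d(x,y)=(x\ominus y)\oplus(y\ominus x)$, and $x\le y$ iff $\lnot x\oplus y=1$. An ideal of $A$ is a subset $I\subseteq A$ containing $0$, closed under $\oplus$, and such that $x\in I$ and $y\le x$ imply $y\in I$; it is proper if $I\ne A$. For an ideal $I$, $A/I$ is the quotient of $A$ by the congruence $x\sim y\iff d(x,y)\in I$. $\mathrm{Rad}(A)$ is the intersection of all maximal (proper) ideals of $A$ (with $\mathrm{Rad}(A)=A=\{0\}$ if $A$ is the one-element algebra). $A$ is semisimple if $\mathrm{Rad}(A)=\{0\}$. $s\mathbb{MV}$ is the full subcategory of $\mathbb{MV}$ whose objects are the semisimple MV-algebras. The functor $S$ sends $A$ to the semisimple algebra $S(A)=A/\mathrm{Rad}(A)$ and a morphism $f\colon A\to B$ to $S(f)\colon A/\mathrm{Rad}(A)\to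 B/\mathrm{Rad}(B)$, $[a]\mapsto[f(a)]$ (well defined since $f(\mathrm{Rad}(A))\subseteq\mathrm{Rad}(B)$). *)

theory Defs
  imports "HOL-Library.FuncSet"
begin

subsection \<open>Categories, functors, adjunctions\<close>

text \<open>
  Hom-sets of different pairs of objects need not be disjoint, so identities, composition and the
  arrow part of a functor take the relevant objects as arguments:
  \<open>Comp C a b c g f\<close> is \<open>g \<circ> f\<close> for \<open>f : a \<rightarrow> b\<close> and \<open>g : b \<rightarrow> c\<close>.  Nothing is required outside
  \<open>Obj C\<close>.
\<close>

record ('o, 'm) cat =
  Obj :: "'o set"
  Hom :: "'o \<Rightarrow> 'o \<Rightarrow> 'm set"
  Id :: "'o \<Rightarrow> 'm"
  Comp :: "'o \<Rightarrow> 'o \<Rightarrow> 'o \<Rightarrow> 'm \<Rightarrow> 'm \<Rightarrow> 'm"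

locale category =
  fixes C :: "('o, 'm) cat"
  assumes Id_in_Hom: "a \<in> Obj C \<Longrightarrow> Id C a \<in> Hom C a a"
    and Comp_in_Hom:
      "\<lbrakk>a \<in> Obj C; b \<in> Obj C; c \<in> Obj C; f \<in> Hom C a b; g \<in> Hom C b c\<rbrakk>
        \<Longrightarrow> Comp C a b c g f \<in> Hom C a c"
    and Comp_Id_right:
      "\<lbrakk>a \<in> Obj C; b \<in> Obj C; f \<in> Hom C a b\<rbrakk> \<Longrightarrow> Comp C a a b f (Id C a) = f"
    and Comp_Id_left:
      "\<lbrakk>a \<in> Obj C; b \<in> Obj C; f \<in> Hom C a b\<rbrakk> \<Longrightarrow> Comp C a b b (Id C b) f = f"
    and Comp_assoc:
      "\<lbrakk>a \<in> Obj C; b \<in> Obj C; c \<in> Obj C; d \<in> Obj C;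
        f \<in> Hom C a b; g \<in> Hom C b c; h \<in> Hom C c d\<rbrakk>
        \<Longrightarrow> Comp C a c d h (Comp C a b c g f) = Comp C a b d (Comp C b c d h g) f"

definition full_subcategory :: "('o, 'm) cat \<Rightarrow> ('o \<Rightarrow> bool) \<Rightarrow> ('o, 'm) cat" where
  "full_subcategory C P = C\<lparr>Obj := {a \<in> Obj C. P a}\<rparr>"

record ('o, 'm, 'p, 'n) func =
  fobj :: "'o \<Rightarrow> 'p"
  farr :: "'o \<Rightarrow> 'o \<Rightarrow> 'm \<Rightarrow> 'n"

locale cat_functor =
  C: category C + D: category D
  for C :: "('o, 'm) cat" and D :: "('p, 'n) cat" +
  fixes F :: "('o, 'm, 'p, 'n) func"
  assumes fobj_in_Obj: "a \<in> Obj C \<Longrightarrow> fobj F a \<in> Obj D"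
    and farr_in_Hom:
      "\<lbrakk>a \<in> Obj C; b \<in> Obj C; f \<in> Hom C a b\<rbrakk>
        \<Longrightarrow> farr F a b f \<in> Hom D (fobj F a) (fobj F b)"
    and farr_Id: "a \<in> Obj C \<Longrightarrow> farr F a a (Id C a) = Id D (fobj F a)"
    and farr_Comp:
      "\<lbrakk>a \<in> Obj C; b \<in> Obj C; c \<in> Obj C; f \<in> Hom C a b; g \<in> Hom C b c\<rbrakk>
        \<Longrightarrow> farr F a c (Comp C a b c g f) =
            Comp D (fobj F a) (fobj F b) (fobj F c) (farr F b c g) (farr F a b f)"

definition inclusion_functor :: "('o, 'm, 'o, 'm) func" where
  "inclusion_functor = \<lparr>fobj = (\<lambda>a. a), farr = (\<lambda>a b f. f)\<rparr>"

text \<open>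
  \<open>right_adjoint C D G F\<close>: the functor \<open>G : D \<rightarrow> C\<close> is right adjoint to \<open>F : C \<rightarrow> D\<close>, i.e. there are
  bijections \<open>Hom D (F a) b \<cong> Hom C a (G b)\<close> natural in \<open>a\<close> and \<open>b\<close>.
\<close>

definition right_adjoint ::
  "('o, 'm) cat \<Rightarrow> ('p, 'n) cat \<Rightarrow> ('p, 'n, 'o, 'm) func \<Rightarrow> ('o, 'm, 'p, 'n) func \<Rightarrow> bool" where
  "right_adjoint C D G F \<longleftrightarrow>
     cat_functor C D F \<and> cat_functor D C G \<and>
     (\<exists>\<Phi>. (\<forall>a\<in>Obj C. \<forall>b\<in>Obj D.
              bij_betw (\<Phi> a b) (Hom D (fobj F a) b) (Hom C a (fobj G b))) \<and>
          (\<forall>a\<in>Obj C. \<forall>a'\<in>Obj C. \<forall>b\<in>Obj D. \<forall>f\<in>Hom C a' a. \<forall>g\<in>Hom D (fobj F a) b.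
              \<Phi> a' b (Comp D (fobj F a') (fobj F a) b g (farr F a' a f)) =
              Comp C a' a (fobj G b) (\<Phi> a b g) f) \<and>
          (\<forall>a\<in>Obj C. \<forall>b\<in>Obj D. \<forall>b'\<in>Obj D. \<forall>g\<in>Hom D (fobj F a) b. \<forall>h\<in>Hom D b b'.
              \<Phi> a b' (Comp D (fobj F a) b b' h g) =
              Comp C a (fobj G b) (fobj G b') (farr G b b' h) (\<Phi> a b g)))"


subsection \<open>MV-algebras\<close>

record 'a mv =
  carrier :: "'a set"
  mv_plus :: "'a \<Rightarrow> 'a \<Rightarrow> 'a" (infixl \<open>\<oplus>\<index>\<close> 65)
  mv_neg :: "'a \<Rightarrow> 'a" (\<open>\<sim>\<index> _\<close> [81] 80)
  mv_zero :: 'a (\<open>\<zero>\<index>\<close>)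

locale mv_algebra =
  fixes A :: "'a mv" (structure)
  assumes zero_closed: "\<zero> \<in> carrier A"
    and plus_closed: "\<lbrakk>x \<in> carrier A; y \<in> carrier A\<rbrakk> \<Longrightarrow> x \<oplus> y \<in> carrier A"
    and neg_closed: "x \<in> carrier A \<Longrightarrow> \<sim> x \<in> carrier A"
    and plus_assoc:
      "\<lbrakk>x \<in> carrier A; y \<in> carrier A; z \<in> carrier A\<rbrakk> \<Longrightarrow> (x \<oplus> y) \<oplus> z = x \<oplus> (y \<oplus> z)"
    and plus_commute: "\<lbrakk>x \<in> carrier A; y \<in> carrier A\<rbrakk> \<Longrightarrow> x \<oplus> y = y \<oplus> x"
    and plus_zero: "x \<in> carrier A \<Longrightarrow> x \<oplus> \<zero> = x"
    and neg_neg: "x \<in> carrier A \<Longrightarrow> \<sim> (\<sim> x) = x"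
    and plus_neg_zero: "x \<in> carrier A \<Longrightarrow> x \<oplus> \<sim> \<zero> = \<sim> \<zero>"
    and lukasiewicz:
      "\<lbrakk>x \<in> carrier A; y \<in> carrier A\<rbrakk> \<Longrightarrow> \<sim> (\<sim> x \<oplus> y) \<oplus> y = \<sim> (\<sim> y \<oplus> x) \<oplus> x"

definition mv_one :: "'a mv \<Rightarrow> 'a" (\<open>\<one>\<index>\<close>) where
  "\<one>\<^bsub>A\<^esub> = \<sim>\<^bsub>A\<^esub> \<zero>\<^bsub>A\<^esub>"

definition mv_minus :: "'a mv \<Rightarrow> 'a \<Rightarrow> 'a \<Rightarrow> 'a" (infixl \<open>\<ominus>\<index>\<close> 65) where
  "x \<ominus>\<^bsub>A\<^esub> y = \<sim>\<^bsub>A\<^esub> (\<sim>\<^bsub>A\<^esub> x \<oplus>\<^bsub>A\<^esub> y)"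

definition mv_dist :: "'a mv \<Rightarrow> 'a \<Rightarrow> 'a \<Rightarrow> 'a" where
  "mv_dist A x y = (x \<ominus>\<^bsub>A\<^esub> y) \<oplus>\<^bsub>A\<^esub> (y \<ominus>\<^bsub>A\<^esub> x)"

definition mv_le :: "'a mv \<Rightarrow> 'a \<Rightarrow> 'a \<Rightarrow> bool" (infix \<open>\<sqsubseteq>\<index>\<close> 50) where
  "x \<sqsubseteq>\<^bsub>A\<^esub> y \<longleftrightarrow> \<sim>\<^bsub>A\<^esub> x \<oplus>\<^bsub>A\<^esub> y = \<one>\<^bsub>A\<^esub>"

text \<open>Morphisms are extensional functions, so that equality of morphisms is equality on the carrier.\<close>

definition mv_hom :: "'a mv \<Rightarrow> 'b mv \<Rightarrow> ('a \<Rightarrow> 'b) set" where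
  "mv_hom A B = {f \<in> carrier A \<rightarrow>\<^sub>E carrier B.
     (\<forall>x\<in>carrier A. \<forall>y\<in>carrier A. f (x \<oplus>\<^bsub>A\<^esub> y) = f x \<oplus>\<^bsub>B\<^esub> f y) \<and>
     (\<forall>x\<in>carrier A. f (\<sim>\<^bsub>A\<^esub> x) = \<sim>\<^bsub>B\<^esub> f x) \<and>
     f \<zero>\<^bsub>A\<^esub> = \<zero>\<^bsub>B\<^esub>}"

definition mv_ideal :: "'a mv \<Rightarrow> 'a set \<Rightarrow> bool" where
  "mv_ideal A I \<longleftrightarrow> I \<subseteq> carrier A \<and> \<zero>\<^bsub>A\<^esub> \<in> I \<and>
     (\<forall>x\<in>I. \<forall>y\<in>I. x \<oplus>\<^bsub>A\<^esub> y \<in> I) \<and>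
     (\<forall>x\<in>I. \<forall>y\<in>carrier A. y \<sqsubseteq>\<^bsub>A\<^esub> x \<longrightarrow> y \<in> I)"

definition proper_ideal :: "'a mv \<Rightarrow> 'a set \<Rightarrow> bool" where
  "proper_ideal A I \<longleftrightarrow> mv_ideal A I \<and> I \<noteq> carrier A"

definition maximal_ideal :: "'a mv \<Rightarrow> 'a set \<Rightarrow> bool" where
  "maximal_ideal A M \<longleftrightarrow> proper_ideal A M \<and> (\<forall>I. proper_ideal A I \<and> M \<subseteq> I \<longrightarrow> I = M)"

text \<open>
  The intersection is taken inside the carrier, so the one-element algebra, which has no maximal
  ideals, is its own radical.
\<close>

definition Rad :: "'a mv \<Rightarrow> 'a set" where
  "Rad A = {x \<in> carrier A. \<forall>M. maximal_ideal A M \<longrightarrow> x \<in> M}"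

definition semisimple :: "'a mv \<Rightarrow> bool" where
  "semisimple A \<longleftrightarrow> Rad A = {\<zero>\<^bsub>A\<^esub>}"

definition ideal_cong :: "'a mv \<Rightarrow> 'a set \<Rightarrow> ('a \<times> 'a) set" where
  "ideal_cong A I = {(x, y). x \<in> carrier A \<and> y \<in> carrier A \<and> mv_dist A x y \<in> I}"

definition mv_quotient :: "'a mv \<Rightarrow> 'a set \<Rightarrow> 'a set mv" where
  "mv_quotient A I =
     \<lparr>carrier = carrier A // ideal_cong A I,
      mv_plus = (\<lambda>X Y. \<Union>x\<in>X. \<Union>y\<in>Y. ideal_cong A I `` {x \<oplus>\<^bsub>A\<^esub> y}),
      mv_neg = (\<lambda>X. \<Union>x\<in>X. ideal_cong A I `` {\<sim>\<^bsub>A\<^esub> x}),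
      mv_zero = ideal_cong A I `` {\<zero>\<^bsub>A\<^esub>}\<rparr>"


subsection \<open>Universes\<close>

text \<open>
  The quotient of an algebra over \<open>'u\<close> is an algebra over \<open>'u set\<close>, whereas a functor between
  categories of MV-algebras needs \<open>A\<close> and its quotient to be objects over the same type.  As usual,
  categories of MV-algebras are therefore formed relative to a universe: the type \<open>'u\<close> with a notion
  of small set, where \<open>code X\<close> is the element of \<open>'u\<close> that stands for the small set \<open>X\<close>.
  Objects are the algebras with a small carrier.
\<close>

locale small_universe =
  fixes small :: "'u set \<Rightarrow> bool" and code :: "'u set \<Rightarrow> 'u"
  assumes small_subset: "\<lbrakk>small X; Y \<subseteq> X\<rbrakk> \<Longrightarrow> small Y"
    and small_image: "\<And>f :: 'u \<Rightarrow> 'u. small X \<Longrightarrow> small (f ` X)"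
    and inj_code: "inj_on code {X. small X}"

text \<open>
  Universes exist for every prescribed size: for infinite \<open>'a\<close>, the type \<open>'a set\<close> is a universe
  whose small sets are those of cardinality at most that of \<open>'a\<close>; so every MV-algebra over \<open>'a\<close>
  has isomorphic copies among the objects.
\<close>

lemma small_universe_exists:
  assumes inf: "infinite (UNIV :: 'a set)"
  shows "\<exists>code. small_universe (\<lambda>X :: 'a set set. \<exists>f :: 'a set \<Rightarrow> 'a. inj_on f X) code"
proof -
  have "(card_of ((UNIV :: 'a set) \<times> (UNIV :: 'a set)), card_of (UNIV :: 'a set)) \<in> ordIso"
    using inf by (rule card_of_Times_same_infinite)
  then obtain q :: "'a \<times> 'a \<Rightarrow> 'a" where "bij_betw q (UNIV \<times> UNIV) UNIV"
    using card_of_ordIso by blast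
  then have q: "inj q" by (simp add: bij_betw_def)
  define h where "h X = (SOME f :: 'a set \<Rightarrow> 'a. inj_on f X)" for X
  have h: "inj_on (h X) X" if "\<exists>f :: 'a set \<Rightarrow> 'a. inj_on f X" for X
    using someI_ex[OF that] by (simp add: h_def)
  obtain u v :: 'a where uv: "u \<noteq> v"
    using inf by (metis UNIV_I finite.simps finite_subset subsetI singletonI)
  \<comment> \<open>Tag \<open>u\<close> records the indices of the members of \<open>X\<close>, tag \<open>v\<close> their elements.\<close>
  define code where
    "code X = {q (u, h X x) | x. x \<in> X} \<union> {q (v, q (h X x, y)) | x y. x \<in> X \<and> y \<in> x}" for X
  have idx: "q (u, i) \<in> code X \<longleftrightarrow> i \<in> h X ` X" for i X
    using q uv by (auto simp: code_def inj_eq)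
  have elt: "q (v, q (i, y)) \<in> code X \<longleftrightarrow> (\<exists>x\<in>X. i = h X x \<and> y \<in> x)" for i y X
    using q uv by (auto simp: code_def inj_eq)
  have decode: "X = (\<lambda>i. {y. q (v, q (i, y)) \<in> code X}) ` {i. q (u, i) \<in> code X}"
    if "\<exists>f :: 'a set \<Rightarrow> 'a. inj_on f X" for X
  proof -
    have "{y. q (v, q (h X x, y)) \<in> code X} = x" if "x \<in> X" for x
      using h[OF \<open>\<exists>f. inj_on f X\<close>] that unfolding elt by (auto dest: inj_onD)
    then show ?thesis unfolding idx by (auto simp: image_iff)
  qed
  have "small_universe (\<lambda>X :: 'a set set. \<exists>f :: 'a set \<Rightarrow> 'a. inj_on f X) code"
  proof
    fix X Y :: "'a set set" assume "\<exists>f :: 'a set \<Rightarrow> 'a. inj_on f X" "Y \<subseteq> X"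
    then show "\<exists>f :: 'a set \<Rightarrow> 'a. inj_on f Y" by (meson inj_on_subset)
  next
    fix X :: "'a set set" and g :: "'a set \<Rightarrow> 'a set"
    assume "\<exists>f :: 'a set \<Rightarrow> 'a. inj_on f X"
    then obtain f :: "'a set \<Rightarrow> 'a" where f: "inj_on f X" ..
    have "inj_on (f \<circ> inv_into X g) (g ` X)"
      by (intro comp_inj_on inj_on_inv_into subset_refl inj_on_subset[OF f])
        (auto intro: inv_into_into)
    then show "\<exists>f :: 'a set \<Rightarrow> 'a. inj_on f (g ` X)" by blast
  next
    show "inj_on code {X. \<exists>f :: 'a set \<Rightarrow> 'a. inj_on f X}"
    proof (rule inj_onI)
      fix X Y
      assume X: "X \<in> {X. \<exists>f :: 'a set \<Rightarrow> 'a. inj_on f X}"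
        and Y: "Y \<in> {X. \<exists>f :: 'a set \<Rightarrow> 'a. inj_on f X}" and eq: "code X = code Y"
      have "X = (\<lambda>i. {y. q (v, q (i, y)) \<in> code Y}) ` {i. q (u, i) \<in> code Y}"
        using decode[of X] X unfolding eq by simp
      also have "\<dots> = Y" using decode[of Y] Y by simp
      finally show "X = Y" .
    qed
  qed
  then show ?thesis by (rule exI[of _ code])
qed


subsection \<open>The categories of MV-algebras and the functor \<open>S\<close>\<close>

definition MV :: "('u set \<Rightarrow> bool) \<Rightarrow> ('u mv, 'u \<Rightarrow> 'u) cat" where
  "MV small =
     \<lparr>Obj = {A. mv_algebra A \<and> small (carrier A)},
      Hom = mv_hom,
      Id = (\<lambda>A. \<lambda>x\<in>carrier A. x),
      Comp = (\<lambda>A B C g f. compose (carrier A) g f)\<rparr>"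

definition sMV :: "('u set \<Rightarrow> bool) \<Rightarrow> ('u mv, 'u \<Rightarrow> 'u) cat" where
  "sMV small = full_subcategory (MV small) semisimple"

text \<open>The isomorphic copy of \<open>A\<close> along a map \<open>c\<close> that is injective on the carrier of \<open>A\<close>.\<close>

definition mv_transport :: "('a \<Rightarrow> 'b) \<Rightarrow> 'a mv \<Rightarrow> 'b mv" where
  "mv_transport c A =
     (let e = inv_into (carrier A) c in
      \<lparr>carrier = c ` carrier A,
       mv_plus = (\<lambda>x y. c (e x \<oplus>\<^bsub>A\<^esub> e y)),
       mv_neg = (\<lambda>x. c (\<sim>\<^bsub>A\<^esub> e x)),
       mv_zero = c \<zero>\<^bsub>A\<^esub>\<rparr>)"

definition S_obj :: "('u set \<Rightarrow> 'u) \<Rightarrow> 'u mv \<Rightarrow> 'u mv" where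
  "S_obj code A = mv_transport code (mv_quotient A (Rad A))"

text \<open>\<open>[a] \<mapsto> [f a]\<close>, with classes replaced by their codes.\<close>

definition S_arr :: "('u set \<Rightarrow> 'u) \<Rightarrow> 'u mv \<Rightarrow> 'u mv \<Rightarrow> ('u \<Rightarrow> 'u) \<Rightarrow> 'u \<Rightarrow> 'u" where
  "S_arr code A B f =
     (\<lambda>z\<in>carrier (S_obj code A).
        code (\<Union>a\<in>inv_into (carrier (mv_quotient A (Rad A))) code z.
                ideal_cong B (Rad B) `` {f a}))"

definition S_functor :: "('u set \<Rightarrow> 'u) \<Rightarrow> ('u mv, 'u \<Rightarrow> 'u, 'u mv, 'u \<Rightarrow> 'u) func" where
  "S_functor code = \<lparr>fobj = S_obj code, farr = S_arr code\<rparr>"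

end

theory Submission
  imports Defs
begin

text \<open>
  A proper ideal \<open>M\<close> is maximal iff for every \<open>x \<notin> M\<close> some multiple satisfies \<open>\<not>(n x) \<in> M\<close>.
  This criterion passes to preimages under morphisms, so \<open>f (Rad A) \<subseteq> Rad B\<close>, and to images of
  maximal ideals under surjections with kernel \<open>Rad A\<close>, so \<open>A / Rad A\<close> is semisimple.  If \<open>B\<close> is
  semisimple, every morphism \<open>A \<rightarrow> B\<close> thus kills \<open>Rad A\<close> and factors uniquely through the
  projection \<open>A \<rightarrow> A / Rad A\<close>, which is therefore the unit of the adjunction.
\<close>

subsection \<open>Arithmetic and order\<close>

context mv_algebra
begin

lemma one_closed: "\<one> \<in> carrier A"
  by (simp add: mv_one_def neg_closed zero_closed)

lemma minus_closed: "\<lbrakk>x \<in> carrier A; y \<in> carrier A\<rbrakk> \<Longrightarrow> x \<ominus> y \<in> carrier A"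
  by (simp add: mv_minus_def neg_closed plus_closed)

lemmas closed = zero_closed one_closed plus_closed neg_closed minus_closed

lemma zero_plus: "x \<in> carrier A \<Longrightarrow> \<zero> \<oplus> x = x"
  using plus_commute plus_zero zero_closed by force

lemma neg_zero: "\<sim> \<zero> = \<one>"
  by (simp add: mv_one_def)

lemma neg_one: "\<sim> \<one> = \<zero>"
  by (simp add: mv_one_def neg_neg zero_closed)

lemma plus_one: "x \<in> carrier A \<Longrightarrow> x \<oplus> \<one> = \<one>"
  by (simp add: mv_one_def plus_neg_zero)

lemma one_plus: "x \<in> carrier A \<Longrightarrow> \<one> \<oplus> x = \<one>"
  using plus_commute plus_one one_closed by force

lemma plus_left_commute:
  "\<lbrakk>x \<in> carrier A; y \<in> carrier A; z \<in> carrier A\<rbrakk> \<Longrightarrow> x \<oplus> (y \<oplus> z) = y \<oplus> (x \<oplus> z)"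
  by (metis plus_assoc plus_commute)

lemmas plus_ac = plus_assoc plus_commute plus_left_commute

text \<open>The Lukasiewicz axiom at \<open>y = \<one>\<close>: its left side collapses to
  \<open>\<one>\<close>, its right side to \<open>\<sim> x \<oplus> x\<close>.\<close>

lemma neg_plus_self: "x \<in> carrier A \<Longrightarrow> \<sim> x \<oplus> x = \<one>"
  using lukasiewicz[of x "\<one>"] by (simp add: closed plus_one neg_one zero_plus)

lemma le_refl: "x \<in> carrier A \<Longrightarrow> x \<sqsubseteq> x"
  by (simp add: mv_le_def neg_plus_self)

text \<open>If \<open>\<sim> x \<oplus> y = \<one>\<close>, one side of the Lukasiewicz axiom
  reduces to \<open>y\<close> and the other is \<open>(y \<ominus> x) \<oplus> x\<close>. So going
  up in the order is adding something, which is how transitivity and monotonicity are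
  obtained.\<close>

lemma le_plus_minus:
  assumes "x \<in> carrier A" "y \<in> carrier A" "x \<sqsubseteq> y"
  shows "y = x \<oplus> (y \<ominus> x)"
proof -
  have "y = \<sim> (\<sim> x \<oplus> y) \<oplus> y"
    using assms by (simp add: mv_le_def neg_one zero_plus)
  also have "\<dots> = (y \<ominus> x) \<oplus> x"
    using assms by (simp add: lukasiewicz mv_minus_def)
  finally show ?thesis using assms by (simp add: plus_commute closed)
qed

lemma le_plus_left:
  assumes "x \<in> carrier A" "y \<in> carrier A"
  shows "x \<sqsubseteq> x \<oplus> y"
  using assms by (simp add: mv_le_def plus_assoc[symmetric] closed neg_plus_self one_plus)

lemma le_plus_right: "\<lbrakk>x \<in> carrier A; y \<in> carrier A\<rbrakk> \<Longrightarrow> y \<sqsubseteq> x \<oplus> y"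
  by (metis le_plus_left plus_commute)

text \<open>The two hypotheses reduce the two sides of the Lukasiewicz axiom to \<open>y\<close> and
  \<open>x\<close>.\<close>

lemma le_antisym: "\<lbrakk>x \<in> carrier A; y \<in> carrier A; x \<sqsubseteq> y; y \<sqsubseteq> x\<rbrakk> \<Longrightarrow> x = y"
  unfolding mv_le_def by (metis lukasiewicz neg_one zero_plus)

lemma le_trans:
  assumes "x \<in> carrier A" "y \<in> carrier A" "z \<in> carrier A" "x \<sqsubseteq> y" "y \<sqsubseteq> z"
  shows "x \<sqsubseteq> z"
proof -
  have "z = x \<oplus> ((y \<ominus> x) \<oplus> (z \<ominus> y))"
    by (metis assms le_plus_minus minus_closed plus_assoc)
  then show ?thesis by (metis assms(1-3) le_plus_left closed(3) minus_closed)
qed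

lemma plus_mono:
  assumes "x \<in> carrier A" "x' \<in> carrier A" "y \<in> carrier A" "y' \<in> carrier A"
    and "x \<sqsubseteq> x'" "y \<sqsubseteq> y'"
  shows "x \<oplus> y \<sqsubseteq> x' \<oplus> y'"
proof -
  have "x' \<oplus> y' = (x \<oplus> (x' \<ominus> x)) \<oplus> (y \<oplus> (y' \<ominus> y))"
    using assms le_plus_minus by metis
  also have "\<dots> = (x \<oplus> y) \<oplus> ((x' \<ominus> x) \<oplus> (y' \<ominus> y))"
    using assms by (simp add: plus_ac closed)
  finally show ?thesis using assms by (simp add: le_plus_left closed)
qed

lemma zero_le: "x \<in> carrier A \<Longrightarrow> \<zero> \<sqsubseteq> x"
  by (simp add: mv_le_def neg_zero one_plus)

lemma le_one: "x \<in> carrier A \<Longrightarrow> x \<sqsubseteq> \<one>"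
  by (simp add: mv_le_def plus_one closed)

text \<open>Residuation: after unfolding and reassociating, both sides are the same equation. Bounds
  on differences thereby become inequalities between sums.\<close>

lemma minus_le_iff:
  assumes "x \<in> carrier A" "y \<in> carrier A" "z \<in> carrier A"
  shows "x \<ominus> y \<sqsubseteq> z \<longleftrightarrow> x \<sqsubseteq> y \<oplus> z"
  using assms by (simp add: mv_le_def mv_minus_def neg_neg plus_assoc closed)

lemma le_plus_of_minus: "\<lbrakk>x \<in> carrier A; y \<in> carrier A\<rbrakk> \<Longrightarrow> x \<sqsubseteq> y \<oplus> (x \<ominus> y)"
  by (simp add: minus_le_iff[symmetric] le_refl closed)

lemma minus_eq_zero_iff:
  assumes "x \<in> carrier A" "y \<in> carrier A"
  shows "x \<ominus> y = \<zero> \<longleftrightarrow> x \<sqsubseteq> y"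
  using assms minus_le_iff[of x y "\<zero>"]
  by (metis le_antisym le_refl minus_closed plus_zero zero_closed zero_le)

lemma minus_self: "x \<in> carrier A \<Longrightarrow> x \<ominus> x = \<zero>"
  by (simp add: minus_eq_zero_iff le_refl)

lemma minus_zero: "x \<in> carrier A \<Longrightarrow> x \<ominus> \<zero> = x"
  by (simp add: mv_minus_def plus_zero neg_neg closed)

lemma minus_neg_neg:
  "\<lbrakk>x \<in> carrier A; y \<in> carrier A\<rbrakk> \<Longrightarrow> \<sim> x \<ominus> \<sim> y = y \<ominus> x"
  by (simp add: mv_minus_def neg_neg plus_commute closed)

text \<open>By residuation it suffices to bound \<open>x\<close> by \<open>z\<close> plus both
  differences, and \<open>x\<close> is below \<open>y \<oplus> (x \<ominus> y)\<close>, where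
  \<open>y\<close> is below \<open>z \<oplus> (y \<ominus> z)\<close>. This will give transitivity
  of the congruence of an ideal.\<close>

lemma minus_triangle:
  assumes "x \<in> carrier A" "y \<in> carrier A" "z \<in> carrier A"
  shows "x \<ominus> z \<sqsubseteq> (x \<ominus> y) \<oplus> (y \<ominus> z)"
proof -
  have "y \<oplus> (x \<ominus> y) \<sqsubseteq> (z \<oplus> (y \<ominus> z)) \<oplus> (x \<ominus> y)"
    using assms by (intro plus_mono le_plus_of_minus le_refl closed)
  then have "x \<sqsubseteq> (z \<oplus> (y \<ominus> z)) \<oplus> (x \<ominus> y)"
    using assms le_plus_of_minus[of x y] le_trans closed by metis
  also have "\<dots> = z \<oplus> ((x \<ominus> y) \<oplus> (y \<ominus> z))"
    using assms by (simp add: plus_ac closed)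
  finally show ?thesis using assms by (simp add: minus_le_iff closed)
qed

text \<open>Residuation again, from the sum of
  \<open>x \<sqsubseteq> x' \<oplus> (x \<ominus> x')\<close> and its analogue for \<open>y\<close>.
  This will make the congruence of an ideal compatible with addition.\<close>

lemma plus_minus_plus_le:
  assumes "x \<in> carrier A" "x' \<in> carrier A" "y \<in> carrier A" "y' \<in> carrier A"
  shows "(x \<oplus> y) \<ominus> (x' \<oplus> y') \<sqsubseteq> (x \<ominus> x') \<oplus> (y \<ominus> y')"
proof -
  have "x \<oplus> y \<sqsubseteq> (x' \<oplus> (x \<ominus> x')) \<oplus> (y' \<oplus> (y \<ominus> y'))"
    using assms by (intro plus_mono le_plus_of_minus closed)
  also have "\<dots> = (x' \<oplus> y') \<oplus> ((x \<ominus> x') \<oplus> (y \<ominus> y'))"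
    using assms by (simp add: plus_ac closed)
  finally show ?thesis using assms by (simp add: minus_le_iff closed)
qed

end


subsection \<open>Maximal ideals\<close>

definition mv_mult :: "'a mv \<Rightarrow> nat \<Rightarrow> 'a \<Rightarrow> 'a" where
  "mv_mult A n x = (mv_plus A x ^^ n) \<zero>\<^bsub>A\<^esub>"

lemma mv_mult_0 [simp]: "mv_mult A 0 x = \<zero>\<^bsub>A\<^esub>"
  and mv_mult_Suc [simp]: "mv_mult A (Suc n) x = x \<oplus>\<^bsub>A\<^esub> mv_mult A n x"
  by (simp_all add: mv_mult_def)

context mv_algebra
begin

lemma mult_closed: "x \<in> carrier A \<Longrightarrow> mv_mult A n x \<in> carrier A"
  by (induction n) (simp_all add: closed)

lemma mult_add:
  "x \<in> carrier A \<Longrightarrow> mv_mult A (m + n) x = mv_mult A m x \<oplus> mv_mult A n x"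
  by (induction m) (simp_all add: zero_plus plus_assoc mult_closed)

lemma ideal_carrier: "\<lbrakk>mv_ideal A I; x \<in> I\<rbrakk> \<Longrightarrow> x \<in> carrier A"
  by (auto simp: mv_ideal_def)

lemma ideal_zero: "mv_ideal A I \<Longrightarrow> \<zero> \<in> I"
  by (simp add: mv_ideal_def)

lemma ideal_plus: "\<lbrakk>mv_ideal A I; x \<in> I; y \<in> I\<rbrakk> \<Longrightarrow> x \<oplus> y \<in> I"
  by (simp add: mv_ideal_def)

lemma ideal_le: "\<lbrakk>mv_ideal A I; x \<in> I; y \<in> carrier A; y \<sqsubseteq> x\<rbrakk> \<Longrightarrow> y \<in> I"
  by (auto simp: mv_ideal_def)

lemma ideal_mult: "\<lbrakk>mv_ideal A I; x \<in> I\<rbrakk> \<Longrightarrow> mv_mult A n x \<in> I"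
  by (induction n) (simp_all add: ideal_zero ideal_plus)

lemma ideal_of_minus:
  assumes "mv_ideal A I" "x \<in> carrier A" "y \<in> I" "x \<ominus> y \<in> I"
  shows "x \<in> I"
  using assms ideal_le[OF assms(1), of "y \<oplus> (x \<ominus> y)" x] ideal_plus ideal_carrier le_plus_of_minus
  by metis

text \<open>The distance is the sum of the two one-sided differences and bounds each of them.
  Congruence can thus be checked one difference at a time, the other following by symmetry.\<close>

lemma dist_in_ideal_iff:
  assumes "mv_ideal A I" "x \<in> carrier A" "y \<in> carrier A"
  shows "mv_dist A x y \<in> I \<longleftrightarrow> x \<ominus> y \<in> I \<and> y \<ominus> x \<in> I"
proof
  assume d: "mv_dist A x y \<in> I"
  have "x \<ominus> y \<sqsubseteq> mv_dist A x y" "y \<ominus> x \<sqsubseteq> mv_dist A x y"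
    using assms by (simp_all add: mv_dist_def le_plus_left le_plus_right minus_closed)
  then show "x \<ominus> y \<in> I \<and> y \<ominus> x \<in> I"
    using assms ideal_le[OF assms(1) d] minus_closed by blast
qed (simp add: mv_dist_def ideal_plus[OF assms(1)])

text \<open>Since \<open>\<one>\<close> is the greatest element, an ideal containing it is
  everything. Properness becomes a membership condition, which is easy to move along
  morphisms.\<close>

lemma proper_ideal_iff: "proper_ideal A I \<longleftrightarrow> mv_ideal A I \<and> \<one> \<notin> I"
  unfolding proper_ideal_def
  by (metis ideal_carrier ideal_le le_one one_closed subsetI subset_antisym)

text \<open>The set is the ideal generated by \<open>I\<close> and \<open>x\<close>.\<close>

lemma ideal_insert:
  assumes "mv_ideal A I" "x \<in> carrier A"
  shows "mv_ideal A {y \<in> carrier A. \<exists>a\<in>I. \<exists>n. y \<sqsubseteq> a \<oplus> mv_mult A n x}" (is "mv_ideal A ?J")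
  unfolding mv_ideal_def
proof (intro conjI ballI impI)
  show "?J \<subseteq> carrier A" by blast
  show "\<zero> \<in> ?J"
    using assms ideal_zero ideal_carrier by (auto intro!: bexI[of _ "\<zero>"] zero_le closed mult_closed)
next
  fix y z assume "y \<in> ?J" "z \<in> ?J"
  then obtain a m b n where *: "y \<in> carrier A" "z \<in> carrier A" "a \<in> I" "b \<in> I"
    "y \<sqsubseteq> a \<oplus> mv_mult A m x" "z \<sqsubseteq> b \<oplus> mv_mult A n x" by blast
  have ab: "a \<in> carrier A" "b \<in> carrier A" using * assms ideal_carrier by auto
  \<comment> \<open>Adding the two bounds adds the elements of \<open>I\<close> and the
    multiplicities of \<open>x\<close>.\<close>
  have "y \<oplus> z \<sqsubseteq> (a \<oplus> mv_mult A m x) \<oplus> (b \<oplus> mv_mult A n x)"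
    using * ab assms by (intro plus_mono closed mult_closed)
  also have "\<dots> = (a \<oplus> b) \<oplus> mv_mult A (m + n) x"
    using ab assms by (simp add: mult_add plus_ac closed mult_closed)
  finally show "y \<oplus> z \<in> ?J"
    using * assms ideal_plus closed by blast
next
  fix y z assume "y \<in> ?J" and z: "z \<in> carrier A" "z \<sqsubseteq> y"
  then obtain a n where *: "y \<in> carrier A" "a \<in> I" "y \<sqsubseteq> a \<oplus> mv_mult A n x" by blast
  have "z \<sqsubseteq> a \<oplus> mv_mult A n x"
    by (rule le_trans[OF z(1) *(1) _ z(2) *(3)])
      (intro closed mult_closed assms(2) ideal_carrier[OF assms(1) *(2)])
  then show "z \<in> ?J" using z * by blast
qed

text \<open>For a maximal \<open>M\<close> and \<open>x\<close> outside it, the ideal generated by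
  both contains \<open>\<one>\<close>; reading off what this means gives the multiple. The
  right-hand side mentions only elements and operations, no other ideals, so it can be transferred
  along morphisms.\<close>

lemma maximal_ideal_iff:
  "maximal_ideal A M \<longleftrightarrow>
     proper_ideal A M \<and> (\<forall>x\<in>carrier A - M. \<exists>n. \<sim> (mv_mult A n x) \<in> M)"
  (is "_ \<longleftrightarrow> _ \<and> ?crit")
proof (intro iffI conjI)
  assume max: "maximal_ideal A M"
  then show "proper_ideal A M" by (simp add: maximal_ideal_def)
  then have M: "mv_ideal A M" by (simp add: proper_ideal_def)
  show ?crit
  proof
    fix x assume x: "x \<in> carrier A - M"
    let ?J = "{y \<in> carrier A. \<exists>a\<in>M. \<exists>n. y \<sqsubseteq> a \<oplus> mv_mult A n x}"
    have J: "mv_ideal A ?J" using ideal_insert M x by blast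
    have "M \<subseteq> ?J"
      using M x ideal_carrier by (blast intro: le_plus_left mult_closed)
    moreover have "x \<in> ?J"
      using M x ideal_zero[OF M] le_refl
      by (auto intro!: bexI[of _ "\<zero>"] exI[of _ 1] simp: zero_plus plus_zero)
    ultimately have "\<one> \<in> ?J"
      using J max x unfolding maximal_ideal_def proper_ideal_iff by blast
    then obtain a n where a: "a \<in> M" "\<one> \<sqsubseteq> a \<oplus> mv_mult A n x" by blast
    \<comment> \<open>Both \<open>\<one> \<sqsubseteq> a \<oplus> n x\<close> and this inequality
      say that \<open>a \<oplus> n x = \<one>\<close>.\<close>
    have "\<sim> (mv_mult A n x) \<sqsubseteq> a"
      using a M x ideal_carrier[OF M]
      by (simp add: mv_le_def neg_neg neg_one zero_plus closed mult_closed plus_commute)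
    then show "\<exists>n. \<sim> (mv_mult A n x) \<in> M"
      using ideal_le[OF M a(1)] x by (meson DiffD1 neg_closed mult_closed)
  qed
next
  assume *: "proper_ideal A M \<and> ?crit"
  have "I \<subseteq> M" if I: "proper_ideal A I" "M \<subseteq> I" for I
  proof
    fix x assume x: "x \<in> I"
    have I': "mv_ideal A I" "\<one> \<notin> I" using I by (auto simp: proper_ideal_iff)
    show "x \<in> M"
    proof (rule ccontr)
      assume "x \<notin> M"
      then obtain n where "\<sim> (mv_mult A n x) \<in> I"
        using * I x ideal_carrier[OF I'(1)] by blast
      \<comment> \<open>The ideal \<open>I\<close> contains \<open>n x\<close> because it contains
        \<open>x\<close>; together with the complement of \<open>n x\<close> it would contain
        \<open>\<one>\<close>.\<close>
      then have "\<sim> (mv_mult A n x) \<oplus> mv_mult A n x \<in> I"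
        using I' x by (intro ideal_plus ideal_mult)
      then show False
        using I' x ideal_carrier by (simp add: neg_plus_self mult_closed)
    qed
  qed
  then show "maximal_ideal A M" using * unfolding maximal_ideal_def by blast
qed

lemma ideal_Rad: "mv_ideal A (Rad A)"
proof -
  have "mv_ideal A M" if "maximal_ideal A M" for M
    using that by (simp add: maximal_ideal_def proper_ideal_def)
  then have "(\<forall>x\<in>M. \<forall>y\<in>M. x \<oplus> y \<in> M) \<and> (\<forall>x\<in>M. \<forall>y\<in>carrier A. y \<sqsubseteq> x \<longrightarrow> y \<in> M) \<and> \<zero> \<in> M"
    if "maximal_ideal A M" for M
    using that by (simp add: mv_ideal_def)
  then show ?thesis
    unfolding mv_ideal_def[of A "Rad A"] by (auto simp: Rad_def closed)
qed

end


subsection \<open>Morphisms\<close>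

lemma mv_homD:
  assumes "f \<in> mv_hom A B"
  shows mv_hom_funcset: "f \<in> carrier A \<rightarrow>\<^sub>E carrier B"
    and mv_hom_closed: "x \<in> carrier A \<Longrightarrow> f x \<in> carrier B"
    and mv_hom_plus:
      "\<lbrakk>x \<in> carrier A; y \<in> carrier A\<rbrakk> \<Longrightarrow> f (x \<oplus>\<^bsub>A\<^esub> y) = f x \<oplus>\<^bsub>B\<^esub> f y"
    and mv_hom_neg: "x \<in> carrier A \<Longrightarrow> f (\<sim>\<^bsub>A\<^esub> x) = \<sim>\<^bsub>B\<^esub> f x"
    and mv_hom_zero: "f \<zero>\<^bsub>A\<^esub> = \<zero>\<^bsub>B\<^esub>"
  using assms by (simp_all add: mv_hom_def PiE_mem[of f "carrier A" "\<lambda>_. carrier B"])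

lemma mv_hom_eqI:
  assumes "f \<in> mv_hom A B" "g \<in> mv_hom A C" "\<And>x. x \<in> carrier A \<Longrightarrow> f x = g x"
  shows "f = g"
  using assms by (intro extensionalityI[of _ "carrier A"]) (simp_all add: mv_hom_def PiE_def)

section \<open>Ideals and radicals under morphisms, and factorisation\<close>

locale mv_morphism = A: mv_algebra A + B: mv_algebra B for A :: "'a mv" and B :: "'b mv" +
  fixes f
  assumes hom: "f \<in> mv_hom A B"
begin

lemmas closed = mv_hom_closed[OF hom]
lemmas plus = mv_hom_plus[OF hom]
lemmas neg = mv_hom_neg[OF hom]
lemmas zero = mv_hom_zero[OF hom]

lemma one: "f \<one>\<^bsub>A\<^esub> = \<one>\<^bsub>B\<^esub>"
  by (simp add: mv_one_def neg zero A.zero_closed)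

lemma minus: "\<lbrakk>x \<in> carrier A; y \<in> carrier A\<rbrakk> \<Longrightarrow> f (x \<ominus>\<^bsub>A\<^esub> y) = f x \<ominus>\<^bsub>B\<^esub> f y"
  by (simp add: mv_minus_def neg plus A.closed)

lemma le: "\<lbrakk>x \<in> carrier A; y \<in> carrier A; x \<sqsubseteq>\<^bsub>A\<^esub> y\<rbrakk> \<Longrightarrow> f x \<sqsubseteq>\<^bsub>B\<^esub> f y"
  by (simp add: mv_le_def one A.closed flip: neg plus)

lemma mult: "x \<in> carrier A \<Longrightarrow> f (mv_mult A n x) = mv_mult B n (f x)"
  by (induction n) (simp_all add: zero plus A.mult_closed)

lemma vimage_ideal:
  assumes "mv_ideal B J"
  shows "mv_ideal A {x \<in> carrier A. f x \<in> J}"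
  using assms unfolding mv_ideal_def[of A]
  by (auto simp: zero plus A.closed closed B.ideal_zero B.ideal_plus intro: B.ideal_le le)

text \<open>Morphisms commute with multiples and negation, so the criterion for \<open>f x\<close>
  in \<open>B\<close> is the criterion for \<open>x\<close> in \<open>A\<close>. Properness survives
  because \<open>f\<close> preserves \<open>\<one>\<close>.\<close>

lemma vimage_maximal_ideal:
  assumes "maximal_ideal B M"
  shows "maximal_ideal A {x \<in> carrier A. f x \<in> M}"
proof -
  have "\<exists>n. f (\<sim>\<^bsub>A\<^esub> (mv_mult A n x)) \<in> M" if "x \<in> carrier A" "f x \<notin> M" for x
    using that assms by (auto simp: B.maximal_ideal_iff neg mult closed A.mult_closed)
  then show ?thesis
    using assms vimage_ideal
    by (auto simp: A.maximal_ideal_iff B.maximal_ideal_iff A.proper_ideal_iff B.proper_ideal_iff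
        one A.closed A.mult_closed)
qed

text \<open>An element of \<open>Rad A\<close> lies in the preimage of every maximal ideal of
  \<open>B\<close>, these preimages being maximal. This is what makes \<open>S\<close> well defined
  on morphisms.\<close>

lemma Rad: "x \<in> Rad A \<Longrightarrow> f x \<in> Rad B"
  using vimage_maximal_ideal by (auto simp: Rad_def closed)

lemma eq_iff:
  assumes "x \<in> carrier A" "y \<in> carrier A"
  shows "f x = f y \<longleftrightarrow> f (x \<ominus>\<^bsub>A\<^esub> y) = \<zero>\<^bsub>B\<^esub> \<and> f (y \<ominus>\<^bsub>A\<^esub> x) = \<zero>\<^bsub>B\<^esub>"
  using assms B.le_antisym[of "f x" "f y"]
  by (auto simp: minus closed B.minus_eq_zero_iff B.le_refl)

text \<open>Because \<open>M\<close> contains the kernel it is a union of fibres of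
  \<open>f\<close>, so membership in \<open>M\<close> can be tested on images, and the maximality
  criterion carries over through surjectivity.\<close>

lemma image_maximal_ideal:
  assumes surj: "f ` carrier A = carrier B"
    and M: "maximal_ideal A M" and ker: "\<And>x. \<lbrakk>x \<in> carrier A; f x = \<zero>\<^bsub>B\<^esub>\<rbrakk> \<Longrightarrow> x \<in> M"
  shows "maximal_ideal B (f ` M)" and "x \<in> carrier A \<Longrightarrow> f x \<in> f ` M \<longleftrightarrow> x \<in> M"
proof -
  have I: "mv_ideal A M" and one_M: "\<one>\<^bsub>A\<^esub> \<notin> M"
    and crit: "\<And>x. x \<in> carrier A \<Longrightarrow> x \<notin> M \<Longrightarrow> \<exists>n. \<sim>\<^bsub>A\<^esub> (mv_mult A n x) \<in> M"
    using M by (auto simp: A.maximal_ideal_iff A.proper_ideal_iff)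
  note MA = A.ideal_carrier[OF I]
  \<comment> \<open>\<open>f x \<sqsubseteq> f m\<close> says that \<open>f\<close> kills
    \<open>x \<ominus> m\<close>, which therefore lies in \<open>M\<close>. This gives both the
    fibre property and downward closure of the image.\<close>
  have below: "x \<in> M" if "x \<in> carrier A" "m \<in> M" "f x \<sqsubseteq>\<^bsub>B\<^esub> f m" for x m
  proof (rule A.ideal_of_minus[OF I that(1,2)])
    have "f (x \<ominus>\<^bsub>A\<^esub> m) = \<zero>\<^bsub>B\<^esub>"
      using that MA by (simp add: minus B.minus_eq_zero_iff closed)
    then show "x \<ominus>\<^bsub>A\<^esub> m \<in> M" using that MA by (intro ker A.minus_closed)
  qed
  show mem: "f x \<in> f ` M \<longleftrightarrow> x \<in> M" if "x \<in> carrier A" for x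
  proof
    assume "f x \<in> f ` M"
    then obtain m where "m \<in> M" "f x = f m" by blast
    then show "x \<in> M" using below[OF that] B.le_refl closed[OF that] by simp
  qed simp
  have "mv_ideal B (f ` M)"
    unfolding mv_ideal_def
  proof (intro conjI ballI impI)
    show "f ` M \<subseteq> carrier B" using MA closed by blast
    show "\<zero>\<^bsub>B\<^esub> \<in> f ` M" using A.ideal_zero[OF I] by (simp flip: zero)
  next
    fix x y assume "x \<in> f ` M" "y \<in> f ` M"
    then obtain a b where "a \<in> M" "b \<in> M" "x = f a" "y = f b" by blast
    then show "x \<oplus>\<^bsub>B\<^esub> y \<in> f ` M"
      using A.ideal_plus[OF I] MA by (simp flip: plus)
  next
    fix x y assume "x \<in> f ` M" "y \<in> carrier B" "y \<sqsubseteq>\<^bsub>B\<^esub> x"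
    moreover from this obtain a m where "y = f a" "a \<in> carrier A" "x = f m" "m \<in> M"
      unfolding surj[symmetric] by blast
    ultimately show "y \<in> f ` M" using below by blast
  qed
  moreover have "\<one>\<^bsub>B\<^esub> \<notin> f ` M"
    using mem[of "\<one>\<^bsub>A\<^esub>"] one_M by (simp add: one A.closed)
  moreover have "\<exists>n. \<sim>\<^bsub>B\<^esub> (mv_mult B n y) \<in> f ` M" if "y \<in> carrier B" "y \<notin> f ` M" for y
  proof -
    obtain x where x: "x \<in> carrier A" "y = f x" using \<open>y \<in> carrier B\<close> surj by blast
    then have "x \<notin> M" using that by blast
    with x crit obtain n where "\<sim>\<^bsub>A\<^esub> (mv_mult A n x) \<in> M" by blast
    then have "f (\<sim>\<^bsub>A\<^esub> (mv_mult A n x)) \<in> f ` M" by blast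
    then show ?thesis using x by (auto simp: neg mult A.mult_closed)
  qed
  ultimately show "maximal_ideal B (f ` M)"
    by (auto simp: B.maximal_ideal_iff B.proper_ideal_iff)
qed

text \<open>Every maximal ideal of \<open>A\<close> contains the kernel \<open>Rad A\<close>, so its
  image is maximal in \<open>B\<close>. If \<open>f x\<close> is in \<open>Rad B\<close>, then
  \<open>x\<close> lies in all maximal ideals of \<open>A\<close>, that is, in the kernel.\<close>

lemma semisimple_image:
  assumes surj: "f ` carrier A = carrier B"
    and ker: "\<And>x. x \<in> carrier A \<Longrightarrow> f x = \<zero>\<^bsub>B\<^esub> \<longleftrightarrow> x \<in> Rad A"
  shows "semisimple B"
proof -
  have "f x = \<zero>\<^bsub>B\<^esub>" if x: "x \<in> carrier A" "f x \<in> Rad B" for x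
  proof -
    have "x \<in> M" if M: "maximal_ideal A M" for M
    proof -
      have "\<And>x. \<lbrakk>x \<in> carrier A; f x = \<zero>\<^bsub>B\<^esub>\<rbrakk> \<Longrightarrow> x \<in> M"
        using ker M by (auto simp: Rad_def)
      note image = image_maximal_ideal[OF surj M this]
      have "f x \<in> f ` M" using x(2) image(1) by (simp add: Rad_def)
      then show ?thesis using image(2) x(1) by blast
    qed
    then show ?thesis using x ker by (auto simp: Rad_def)
  qed
  moreover have "Rad B \<subseteq> f ` carrier A" by (auto simp: surj Rad_def)
  ultimately have "Rad B \<subseteq> {\<zero>\<^bsub>B\<^esub>}" by blast
  then show ?thesis
    using B.ideal_zero[OF B.ideal_Rad] by (auto simp: semisimple_def)
qed

text \<open>Two preimages of one element have both differences killed by \<open>f\<close>, hence by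
  \<open>g\<close>, so \<open>g\<close> agrees on them by \<open>eq_iff\<close>. The value of
  \<open>h\<close> is thus independent of the preimage chosen by \<open>inv_into\<close>.\<close>

lemma factor:
  assumes surj: "f ` carrier A = carrier B" and C: "mv_algebra C" and g: "g \<in> mv_hom A C"
    and ker: "\<And>x. \<lbrakk>x \<in> carrier A; f x = \<zero>\<^bsub>B\<^esub>\<rbrakk> \<Longrightarrow> g x = \<zero>\<^bsub>C\<^esub>"
  shows "\<exists>h\<in>mv_hom B C. compose (carrier A) h f = g"
proof -
  interpret g: mv_morphism A C g
    by (intro mv_morphism.intro mv_morphism_axioms.intro A.mv_algebra_axioms C g)
  define h where "h = (\<lambda>z\<in>carrier B. g (inv_into (carrier A) f z))"
  have h: "h (f x) = g x" if "x \<in> carrier A" for x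
  proof -
    let ?x = "inv_into (carrier A) f (f x)"
    have "?x \<in> carrier A" "f ?x = f x"
      using that by (auto intro: inv_into_into f_inv_into_f)
    then have "g ?x = g x"
      using that eq_iff[of ?x x] g.eq_iff[of ?x x] ker A.minus_closed by blast
    then show ?thesis using that by (simp add: h_def closed)
  qed
  have "h \<in> mv_hom B C"
    unfolding mv_hom_def
  proof (intro CollectI conjI ballI)
    show "h \<in> carrier B \<rightarrow>\<^sub>E carrier C"
      unfolding h_def restrict_PiE_iff surj[symmetric] by (blast intro: g.closed inv_into_into)
    show "h \<zero>\<^bsub>B\<^esub> = \<zero>\<^bsub>C\<^esub>" 
      using h[OF A.zero_closed] by (simp add: zero g.zero)
  next
    fix x y assume "x \<in> carrier B" "y \<in> carrier B"
    then show "h (x \<oplus>\<^bsub>B\<^esub> y) = h x \<oplus>\<^bsub>C\<^esub> h y"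
      unfolding surj[symmetric] by (auto simp: h g.plus A.closed simp flip: plus)
  next
    fix x assume "x \<in> carrier B"
    then show "h (\<sim>\<^bsub>B\<^esub> x) = \<sim>\<^bsub>C\<^esub> h x"
      unfolding surj[symmetric] by (auto simp: h g.neg A.closed simp flip: neg)
  qed
  moreover have "compose (carrier A) h f = g"
  proof
    \<comment> \<open>Outside the carrier both sides are \<open>undefined\<close>.\<close>
    show "compose (carrier A) h f x = g x" for x
      by (cases "x \<in> carrier A") (simp_all add: compose_def h PiE_arb[OF mv_hom_funcset[OF g]])
  qed
  ultimately show ?thesis by blast
qed

end

section \<open>Identities, composites and homomorphic images\<close>

lemma mv_hom_Id: "mv_algebra A \<Longrightarrow> (\<lambda>x\<in>carrier A. x) \<in> mv_hom A A"
  by (auto simp: mv_hom_def mv_algebra.closed)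

lemma mv_hom_compose:
  assumes "mv_algebra A" and f: "f \<in> mv_hom A B" and g: "g \<in> mv_hom B C"
  shows "compose (carrier A) g f \<in> mv_hom A C"
proof -
  note homs = mv_homD(2-)[OF f] mv_homD(2-)[OF g]
  have "compose (carrier A) g f \<in> carrier A \<rightarrow>\<^sub>E carrier C"
    by (simp add: compose_def homs)
  then show ?thesis
    by (simp add: mv_hom_def[of A C] compose_def homs mv_algebra.closed[OF assms(1)])
qed

text \<open>Equations pass to homomorphic images; \<open>mv_hom\<close> does not presuppose that
  \<open>B\<close> is an algebra. Applied to the projection, this replaces checking the axioms on
  coded classes.\<close>

lemma (in mv_algebra) mv_algebra_image:
  assumes hom: "h \<in> mv_hom A B" and surj: "h ` carrier A = carrier B"
  shows "mv_algebra B"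
proof
  note ops = mv_homD(2-)[OF hom]
  \<comment> \<open>The reversed homomorphism equations pull each term over \<open>B\<close> into
    the form \<open>h\<close> of a term over \<open>A\<close>, where the axioms are
    available.\<close>
  note [simp] = closed and [simp] = ops(1) and [simp] = ops(2-4)[symmetric]
  show "\<zero>\<^bsub>B\<^esub> \<in> carrier B" by simp
  fix x assume "x \<in> carrier B"
  then obtain a where a [simp]: "a \<in> carrier A" and x: "x = h a"
    unfolding surj[symmetric] by blast
  show "\<sim>\<^bsub>B\<^esub> x \<in> carrier B" and "x \<oplus>\<^bsub>B\<^esub> \<zero>\<^bsub>B\<^esub> = x" and "\<sim>\<^bsub>B\<^esub> (\<sim>\<^bsub>B\<^esub> x) = x"
    and "x \<oplus>\<^bsub>B\<^esub> \<sim>\<^bsub>B\<^esub> \<zero>\<^bsub>B\<^esub> = \<sim>\<^bsub>B\<^esub> \<zero>\<^bsub>B\<^esub>"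
    by (simp_all add: x plus_zero neg_neg plus_neg_zero)
  fix y assume "y \<in> carrier B"
  then obtain b where b [simp]: "b \<in> carrier A" and y: "y = h b"
    unfolding surj[symmetric] by blast
  show "x \<oplus>\<^bsub>B\<^esub> y \<in> carrier B" and "x \<oplus>\<^bsub>B\<^esub> y = y \<oplus>\<^bsub>B\<^esub> x"
    by (simp_all add: x y plus_commute[of a b])
  show "\<sim>\<^bsub>B\<^esub> (\<sim>\<^bsub>B\<^esub> x \<oplus>\<^bsub>B\<^esub> y) \<oplus>\<^bsub>B\<^esub> y = \<sim>\<^bsub>B\<^esub> (\<sim>\<^bsub>B\<^esub> y \<oplus>\<^bsub>B\<^esub> x) \<oplus>\<^bsub>B\<^esub> x"
    by (simp add: x y lukasiewicz[of a b])
  fix z assume "z \<in> carrier B"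
  then obtain c where "c \<in> carrier A" and "z = h c"
    unfolding surj[symmetric] by blast
  then show "x \<oplus>\<^bsub>B\<^esub> y \<oplus>\<^bsub>B\<^esub> z = x \<oplus>\<^bsub>B\<^esub> (y \<oplus>\<^bsub>B\<^esub> z)"
    by (simp add: x y plus_assoc)
qed


subsection \<open>Quotients\<close>

context mv_algebra
begin

text \<open>Transitivity is the triangle inequality, applied to each of the two one-sided
  differences.\<close>

lemma equiv_ideal_cong:
  assumes I: "mv_ideal A I"
  shows "equiv (carrier A) (ideal_cong A I)"
proof (rule equivI)
  show "ideal_cong A I \<subseteq> carrier A \<times> carrier A" by (auto simp: ideal_cong_def)
  show "refl_on (carrier A) (ideal_cong A I)"
    using I by (auto simp: refl_on_def ideal_cong_def dist_in_ideal_iff minus_self ideal_zero)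
  show "sym (ideal_cong A I)"
    using I by (auto simp: sym_def ideal_cong_def dist_in_ideal_iff)
  show "trans (ideal_cong A I)"
  proof (rule transI)
    have minus: "x \<ominus> z \<in> I"
      if "x \<in> carrier A" "y \<in> carrier A" "z \<in> carrier A" "x \<ominus> y \<in> I" "y \<ominus> z \<in> I" for x y z
      using ideal_le[OF I ideal_plus[OF I that(4,5)] _ minus_triangle] that
      by (simp add: minus_closed)
    fix x y z assume "(x, y) \<in> ideal_cong A I" "(y, z) \<in> ideal_cong A I"
    then show "(x, z) \<in> ideal_cong A I"
      using minus[of x y z] minus[of z y x] by (auto simp: ideal_cong_def dist_in_ideal_iff[OF I])
  qed
qed

lemma ideal_cong_plus:
  assumes "mv_ideal A I" "(x, x') \<in> ideal_cong A I" "(y, y') \<in> ideal_cong A I"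
  shows "(x \<oplus> y, x' \<oplus> y') \<in> ideal_cong A I"
proof -
  have minus: "(a \<oplus> b) \<ominus> (a' \<oplus> b') \<in> I"
    if "a \<in> carrier A" "a' \<in> carrier A" "b \<in> carrier A" "b' \<in> carrier A"
      and "a \<ominus> a' \<in> I" "b \<ominus> b' \<in> I" for a a' b b'
    using ideal_le[OF assms(1) ideal_plus[OF assms(1) that(5,6)] _ plus_minus_plus_le] that
    by (simp add: closed)
  show ?thesis
    using assms(2,3) minus[of x x' y y'] minus[of x' x y' y]
    by (auto simp: ideal_cong_def dist_in_ideal_iff[OF assms(1)] closed)
qed

text \<open>Negation merely interchanges the two one-sided differences.\<close>

lemma ideal_cong_neg:
  assumes "mv_ideal A I" "(x, x') \<in> ideal_cong A I"
  shows "(\<sim> x, \<sim> x') \<in> ideal_cong A I"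
  using assms by (auto simp: ideal_cong_def dist_in_ideal_iff minus_neg_neg closed)

lemma ideal_cong_zero_iff:
  assumes "mv_ideal A I" "x \<in> carrier A"
  shows "(x, \<zero>) \<in> ideal_cong A I \<longleftrightarrow> x \<in> I"
proof -
  have "\<zero> \<ominus> x = \<zero>" using assms by (simp add: minus_eq_zero_iff zero_le closed)
  then show ?thesis
    using assms by (simp add: ideal_cong_def dist_in_ideal_iff closed minus_zero ideal_zero)
qed

lemma quotient_class_closed:
  "x \<in> carrier A \<Longrightarrow> ideal_cong A I `` {x} \<in> carrier (mv_quotient A I)"
  by (auto simp: mv_quotient_def quotient_def)

text \<open>The unions in \<open>mv_quotient\<close> run over all representatives. As the operations
  respect the congruence, all members of such a union are the same class, so it collapses to that
  class.\<close>

lemma quotient_ops: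
  assumes I: "mv_ideal A I"
  shows quotient_plus: "\<lbrakk>x \<in> carrier A; y \<in> carrier A\<rbrakk> \<Longrightarrow>
      ideal_cong A I `` {x} \<oplus>\<^bsub>mv_quotient A I\<^esub> ideal_cong A I `` {y} = ideal_cong A I `` {x \<oplus> y}"
    and quotient_neg: "x \<in> carrier A \<Longrightarrow>
      \<sim>\<^bsub>mv_quotient A I\<^esub> (ideal_cong A I `` {x}) = ideal_cong A I `` {\<sim> x}"
proof -
  note E = equiv_ideal_cong[OF I]
  have "congruent2 (ideal_cong A I) (ideal_cong A I) (\<lambda>x y. ideal_cong A I `` {x \<oplus> y})"
    by (intro congruent2I' equiv_class_eq[OF E] ideal_cong_plus[OF I])
  then show "ideal_cong A I `` {x} \<oplus>\<^bsub>mv_quotient A I\<^esub> ideal_cong A I `` {y} =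
      ideal_cong A I `` {x \<oplus> y}" if "x \<in> carrier A" "y \<in> carrier A"
    using that by (simp add: mv_quotient_def UN_equiv_class2[OF E E])
  have "congruent (ideal_cong A I) (\<lambda>x. ideal_cong A I `` {\<sim> x})"
    by (intro congruentI equiv_class_eq[OF E] ideal_cong_neg[OF I])
  then show "\<sim>\<^bsub>mv_quotient A I\<^esub> (ideal_cong A I `` {x}) = ideal_cong A I `` {\<sim> x}"
    if "x \<in> carrier A"
    using that by (simp add: mv_quotient_def UN_equiv_class[OF E])
qed

end

section \<open>The coded quotient by the radical and its projection\<close>

lemma mv_transport_ops:
  assumes c: "inj_on c (carrier A)"
  shows "carrier (mv_transport c A) = c ` carrier A"
    and "\<lbrakk>x \<in> carrier A; y \<in> carrier A\<rbrakk> \<Longrightarrow> c x \<oplus>\<^bsub>mv_transport c A\<^esub> c y = c (x \<oplus>\<^bsub>A\<^esub> y)"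
    and "x \<in> carrier A \<Longrightarrow> \<sim>\<^bsub>mv_transport c A\<^esub> (c x) = c (\<sim>\<^bsub>A\<^esub> x)"
    and "\<zero>\<^bsub>mv_transport c A\<^esub> = c \<zero>\<^bsub>A\<^esub>"
  using c by (simp_all add: mv_transport_def Let_def)

definition S_unit :: "('u set \<Rightarrow> 'u) \<Rightarrow> 'u mv \<Rightarrow> 'u \<Rightarrow> 'u" where
  "S_unit code A = (\<lambda>x\<in>carrier A. code (ideal_cong A (Rad A) `` {x}))"

locale small_mv_algebra = small_universe small code + mv_algebra A
  for small :: "'u set \<Rightarrow> bool" and code and A (structure) +
  assumes small_carrier: "small (carrier A)"
begin

text \<open>Each class is a subset of the small carrier, hence small, and \<open>code\<close> is
  injective on small sets.\<close>

lemma inj_on_code: "inj_on code (carrier (mv_quotient A (Rad A)))"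
proof (rule inj_on_subset[OF inj_code])
  show "carrier (mv_quotient A (Rad A)) \<subseteq> {X. small X}"
    using small_subset[OF small_carrier]
    by (auto simp: mv_quotient_def quotient_def ideal_cong_def)
qed

lemmas S_obj_ops = mv_transport_ops[OF inj_on_code, folded S_obj_def]

lemma S_unit_surj: "S_unit code A ` carrier A = carrier (S_obj code A)"
  by (auto simp: S_obj_ops S_unit_def mv_quotient_def quotient_def)

lemma S_unit_hom: "S_unit code A \<in> mv_hom A (S_obj code A)"
proof -
  have "S_unit code A \<in> carrier A \<rightarrow>\<^sub>E carrier (S_obj code A)"
    using S_unit_surj by (auto simp: S_unit_def)
  moreover have "S_unit code A \<zero> = \<zero>\<^bsub>S_obj code A\<^esub>"
    by (simp add: S_unit_def S_obj_ops closed mv_quotient_def)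
  ultimately show ?thesis
    by (simp add: mv_hom_def S_unit_def closed S_obj_ops quotient_class_closed
        quotient_ops[OF ideal_Rad])
qed

lemma S_unit_eq_iff:
  assumes "x \<in> carrier A" "y \<in> carrier A"
  shows "S_unit code A x = S_unit code A y \<longleftrightarrow> (x, y) \<in> ideal_cong A (Rad A)"
  using assms
  by (simp add: S_unit_def inj_on_eq_iff[OF inj_on_code] quotient_class_closed
      eq_equiv_class_iff[OF equiv_ideal_cong[OF ideal_Rad]])

lemma S_unit_kernel: "x \<in> carrier A \<Longrightarrow> S_unit code A x = \<zero>\<^bsub>S_obj code A\<^esub> \<longleftrightarrow> x \<in> Rad A"
  using S_unit_eq_iff[of x "\<zero>"] mv_hom_zero[OF S_unit_hom]
  by (simp add: closed ideal_cong_zero_iff ideal_Rad)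

lemma mv_algebra_S_obj: "mv_algebra (S_obj code A)"
  using mv_algebra_image S_unit_hom S_unit_surj by blast

text \<open>Coding turns the projection into a map from \<open>'u\<close> to \<open>'u\<close>, so
  the new carrier is the image of a small set.\<close>

lemma small_S_obj: "small (carrier (S_obj code A))"
  unfolding S_unit_surj[symmetric] by (rule small_image[OF small_carrier])

sublocale unit: mv_morphism A "S_obj code A" "S_unit code A"
  by (intro mv_morphism.intro mv_morphism_axioms.intro mv_algebra_axioms mv_algebra_S_obj
      S_unit_hom)

lemma semisimple_S_obj: "semisimple (S_obj code A)"
  using unit.semisimple_image S_unit_surj S_unit_kernel by blast

text \<open>The projection is surjective, hence epi. This yields the functor laws and the uniqueness
  of factorisations.\<close>

lemma S_hom_eqI:
  assumes "g \<in> mv_hom (S_obj code A) B" "h \<in> mv_hom (S_obj code A) B'"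
    and "\<And>x. x \<in> carrier A \<Longrightarrow> g (S_unit code A x) = h (S_unit code A x)"
  shows "g = h"
  using assms by (intro mv_hom_eqI[OF assms(1,2)]) (auto simp flip: S_unit_surj)

text \<open>The naturality square of the unit, on elements. Congruence modulo \<open>Rad A\<close>
  is sent to congruence modulo \<open>Rad B\<close>, so the union in \<open>S_arr\<close> is the
  single class of \<open>f x\<close>.\<close>

lemma S_arr_unit:
  assumes B: "mv_algebra B" and f: "f \<in> mv_hom A B" and x: "x \<in> carrier A"
  shows "S_arr code A B f (S_unit code A x) = S_unit code B (f x)"
proof -
  interpret f: mv_morphism A B f
    by (intro mv_morphism.intro mv_morphism_axioms.intro mv_algebra_axioms B f)
  note E = equiv_ideal_cong[OF ideal_Rad]
  have "congruent (ideal_cong A (Rad A)) (\<lambda>a. ideal_cong B (Rad B) `` {f a})"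
  proof (intro congruentI equiv_class_eq[OF f.B.equiv_ideal_cong[OF f.B.ideal_Rad]])
    fix a b assume "(a, b) \<in> ideal_cong A (Rad A)"
    then show "(f a, f b) \<in> ideal_cong B (Rad B)"
      by (auto simp: ideal_cong_def dist_in_ideal_iff f.B.dist_in_ideal_iff ideal_Rad
          f.B.ideal_Rad f.closed f.Rad simp flip: f.minus)
  qed
  then show ?thesis
    using x S_unit_surj unit.closed[OF x]
    by (simp add: S_arr_def f.closed)
      (simp add: S_unit_def x f.closed inv_into_f_f[OF inj_on_code] quotient_class_closed
        UN_equiv_class[OF E])
qed

end

text \<open>Instead of computing with codes, \<open>S_arr\<close> is identified with the
  factorisation through the projection of \<open>A\<close> of the composite of \<open>f\<close> with
  the projection of \<open>B\<close>. That composite kills \<open>Rad A\<close> because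
  \<open>f\<close> maps it into \<open>Rad B\<close>.\<close>

lemma S_arr_hom:
  assumes "small_mv_algebra small code A" "small_mv_algebra small code B" "f \<in> mv_hom A B"
  shows "S_arr code A B f \<in> mv_hom (S_obj code A) (S_obj code B)"
proof -
  interpret A: small_mv_algebra small code A by fact
  interpret B: small_mv_algebra small code B by fact
  interpret f: mv_morphism A B f
    by (intro mv_morphism.intro mv_morphism_axioms.intro A.mv_algebra_axioms
        B.mv_algebra_axioms assms)
  have comp: "compose (carrier A) (S_unit code B) f \<in> mv_hom A (S_obj code B)"
    using A.mv_algebra_axioms assms(3) B.S_unit_hom by (rule mv_hom_compose)
  have "compose (carrier A) (S_unit code B) f x = \<zero>\<^bsub>S_obj code B\<^esub>"
    if "x \<in> carrier A" "S_unit code A x = \<zero>\<^bsub>S_obj code A\<^esub>" for x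
    using that by (simp add: compose_def A.S_unit_kernel B.S_unit_kernel f.closed f.Rad)
  then obtain h where h: "h \<in> mv_hom (S_obj code A) (S_obj code B)"
    and hf: "compose (carrier A) h (S_unit code A) = compose (carrier A) (S_unit code B) f"
    using A.unit.factor[OF A.S_unit_surj B.mv_algebra_S_obj comp] by blast
  have "S_arr code A B f z = h z" for z
  proof (cases "z \<in> carrier (S_obj code A)")
    case True
    then obtain x where "x \<in> carrier A" "z = S_unit code A x" using A.S_unit_surj by blast
    then show ?thesis
      using A.S_arr_unit[OF B.mv_algebra_axioms assms(3)] fun_cong[OF hf, of x]
      by (simp add: compose_def)
  next
    case False
    then show ?thesis
      using PiE_arb[OF mv_hom_funcset[OF h]] by (simp add: S_arr_def)
  qed
  then show ?thesis using h by (metis ext)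
qed


subsection \<open>The adjunction\<close>

lemma category_MV: "category (MV small)"
proof
  fix A B :: "'a mv" and f assume "f \<in> Hom (MV small) A B"
  \<comment> \<open>Extensionality turns the identity laws into equalities of functions, not just
    agreement on the carrier.\<close>
  then have "f \<in> carrier A \<rightarrow> carrier B" "f \<in> extensional (carrier A)"
    by (simp_all add: MV_def mv_hom_def PiE_def)
  then show "Comp (MV small) A A B f (Id (MV small) A) = f"
    and "Comp (MV small) A B B (Id (MV small) B) f = f"
    by (simp_all add: MV_def compose_Id Id_compose)
next
  fix A B C D :: "'a mv" and f g h
  assume "f \<in> Hom (MV small) A B"
  then have "f \<in> carrier A \<rightarrow> carrier B" by (simp add: MV_def mv_hom_closed)
  then show "Comp (MV small) A C D h (Comp (MV small) A B C g f) =
      Comp (MV small) A B D (Comp (MV small) B C D h g) f"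
    by (simp add: MV_def compose_assoc)
qed (auto simp: MV_def mv_hom_Id mv_hom_compose)

lemma category_full_subcategory:
  assumes "category C"
  shows "category (full_subcategory C P)"
proof -
  interpret category C by fact
  show ?thesis
    by unfold_locales
      (auto simp: full_subcategory_def Id_in_Hom Comp_in_Hom Comp_Id_right Comp_Id_left
        Comp_assoc)
qed

lemma inclusion_functor_full_subcategory:
  assumes "category C"
  shows "cat_functor (full_subcategory C P) C inclusion_functor"
  by (intro cat_functor.intro cat_functor_axioms.intro category_full_subcategory assms)
    (auto simp: full_subcategory_def inclusion_functor_def)

section \<open>The functor \<open>S\<close> and the universal property of its unit\<close>

context small_universe
begin

lemma MV_objD: "A \<in> Obj (MV small) \<Longrightarrow> small_mv_algebra small code A"
  by (intro small_mv_algebra.intro small_universe_axioms small_mv_algebra_axioms.intro)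
    (auto simp: MV_def)

lemma sMV_simps:
  "A \<in> Obj (sMV small) \<longleftrightarrow> A \<in> Obj (MV small) \<and> semisimple A"
  "Hom (sMV small) = mv_hom" "Id (sMV small) = (\<lambda>A. \<lambda>x\<in>carrier A. x)"
  "Comp (sMV small) = (\<lambda>A B C g f. compose (carrier A) g f)"
  by (simp_all add: sMV_def full_subcategory_def MV_def)

lemma MV_simps:
  "Hom (MV small) = mv_hom" "Id (MV small) = (\<lambda>A. \<lambda>x\<in>carrier A. x)"
  "Comp (MV small) = (\<lambda>A B C g f. compose (carrier A) g f)"
  by (simp_all add: MV_def)

text \<open>Both functor laws equate morphisms out of a coded quotient, so by
  \<open>S_hom_eqI\<close> they need checking only on projected elements, where
  \<open>S_arr_unit\<close> evaluates them.\<close>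

lemma S_functor: "cat_functor (MV small) (sMV small) (S_functor code)"
proof (intro cat_functor.intro cat_functor_axioms.intro category_MV)
  show "category (sMV small)"
    by (simp add: sMV_def category_full_subcategory category_MV)
next
  fix A assume "A \<in> Obj (MV small)"
  then interpret A: small_mv_algebra small code A by (rule MV_objD)
  show "fobj (S_functor code) A \<in> Obj (sMV small)"
    using A.mv_algebra_S_obj A.small_S_obj A.semisimple_S_obj
    by (simp add: S_functor_def sMV_simps) (simp add: MV_def)
  have Id: "(\<lambda>x\<in>carrier A. x) \<in> mv_hom A A"
    using A.mv_algebra_axioms by (rule mv_hom_Id)
  have "S_arr code A A (\<lambda>x\<in>carrier A. x) = (\<lambda>z\<in>carrier (S_obj code A). z)"
  proof (rule A.S_hom_eqI)
    show "S_arr code A A (\<lambda>x\<in>carrier A. x) \<in> mv_hom (S_obj code A) (S_obj code A)"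
      using A.small_mv_algebra_axioms A.small_mv_algebra_axioms Id by (rule S_arr_hom)
    show "(\<lambda>z\<in>carrier (S_obj code A). z) \<in> mv_hom (S_obj code A) (S_obj code A)"
      by (rule mv_hom_Id[OF A.mv_algebra_S_obj])
  qed (simp add: A.S_arr_unit[OF A.mv_algebra_axioms Id] A.unit.closed)
  then show "farr (S_functor code) A A (Id (MV small) A) =
      Id (sMV small) (fobj (S_functor code) A)"
    by (simp add: S_functor_def sMV_simps MV_simps)
next
  fix A B f
  assume "A \<in> Obj (MV small)" "B \<in> Obj (MV small)" "f \<in> Hom (MV small) A B"
  then show "farr (S_functor code) A B f
      \<in> Hom (sMV small) (fobj (S_functor code) A) (fobj (S_functor code) B)"
    by (simp add: S_functor_def sMV_simps MV_simps S_arr_hom[OF MV_objD MV_objD])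
next
  fix A B C f g
  assume A: "A \<in> Obj (MV small)" and B: "B \<in> Obj (MV small)" and C: "C \<in> Obj (MV small)"
    and "f \<in> Hom (MV small) A B" and "g \<in> Hom (MV small) B C"
  then have f: "f \<in> mv_hom A B" and g: "g \<in> mv_hom B C" by (simp_all add: MV_simps)
  interpret A: small_mv_algebra small code A using A by (rule MV_objD)
  interpret B: small_mv_algebra small code B using B by (rule MV_objD)
  interpret C: small_mv_algebra small code C using C by (rule MV_objD)
  have gf: "compose (carrier A) g f \<in> mv_hom A C"
    using A.mv_algebra_axioms f g by (rule mv_hom_compose)
  have "S_arr code A C (compose (carrier A) g f) =
      compose (carrier (S_obj code A)) (S_arr code B C g) (S_arr code A B f)"
  proof (rule A.S_hom_eqI)
    show "S_arr code A C (compose (carrier A) g f) \<in> mv_hom (S_obj code A) (S_obj code C)"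
      using A.small_mv_algebra_axioms C.small_mv_algebra_axioms gf by (rule S_arr_hom)
    show "compose (carrier (S_obj code A)) (S_arr code B C g) (S_arr code A B f)
        \<in> mv_hom (S_obj code A) (S_obj code C)"
      using A.mv_algebra_S_obj
        S_arr_hom[OF A.small_mv_algebra_axioms B.small_mv_algebra_axioms f]
        S_arr_hom[OF B.small_mv_algebra_axioms C.small_mv_algebra_axioms g]
      by (rule mv_hom_compose)
  qed (simp add: compose_eq A.unit.closed mv_hom_closed[OF f]
      A.S_arr_unit[OF C.mv_algebra_axioms gf] A.S_arr_unit[OF B.mv_algebra_axioms f]
      B.S_arr_unit[OF C.mv_algebra_axioms g])
  then show "farr (S_functor code) A C (Comp (MV small) A B C g f) =
      Comp (sMV small) (fobj (S_functor code) A) (fobj (S_functor code) B)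
        (fobj (S_functor code) C) (farr (S_functor code) B C g) (farr (S_functor code) A B f)"
    by (simp add: S_functor_def sMV_simps MV_simps)
qed

text \<open>Injectivity is surjectivity of the projection. For surjectivity, a morphism into a
  semisimple \<open>B\<close> maps \<open>Rad A\<close> into \<open>Rad B\<close>, which is zero,
  and so factors through the projection.\<close>

lemma S_unit_bij:
  assumes A: "A \<in> Obj (MV small)" and B: "B \<in> Obj (sMV small)"
  shows "bij_betw (\<lambda>g. compose (carrier A) g (S_unit code A))
    (mv_hom (S_obj code A) B) (mv_hom A B)"
proof (rule bij_betw_imageI)
  interpret A: small_mv_algebra small code A using A by (rule MV_objD)
  have B': "mv_algebra B" "Rad B = {\<zero>\<^bsub>B\<^esub>}"
    using B by (auto simp: sMV_simps MV_def semisimple_def)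
  show "inj_on (\<lambda>g. compose (carrier A) g (S_unit code A)) (mv_hom (S_obj code A) B)"
  proof (rule inj_onI)
    fix g h assume gh: "g \<in> mv_hom (S_obj code A) B" "h \<in> mv_hom (S_obj code A) B"
      and eq: "compose (carrier A) g (S_unit code A) = compose (carrier A) h (S_unit code A)"
    show "g = h"
      using gh by (rule A.S_hom_eqI) (metis compose_eq eq)
  qed
  have "f \<in> (\<lambda>g. compose (carrier A) g (S_unit code A)) ` mv_hom (S_obj code A) B"
    if f: "f \<in> mv_hom A B" for f
  proof -
    interpret f: mv_morphism A B f
      by (intro mv_morphism.intro mv_morphism_axioms.intro A.mv_algebra_axioms B' f)
    have "f x = \<zero>\<^bsub>B\<^esub>" if "x \<in> carrier A" "S_unit code A x = \<zero>\<^bsub>S_obj code A\<^esub>" for x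
      using that f.Rad[of x] B' by (simp add: A.S_unit_kernel)
    from A.unit.factor[OF A.S_unit_surj B'(1) f this] show ?thesis by blast
  qed
  moreover have "compose (carrier A) g (S_unit code A) \<in> mv_hom A B"
    if "g \<in> mv_hom (S_obj code A) B" for g
    using A.mv_algebra_axioms A.S_unit_hom that by (rule mv_hom_compose)
  ultimately show "(\<lambda>g. compose (carrier A) g (S_unit code A)) ` mv_hom (S_obj code A) B =
      mv_hom A B"
    by blast
qed

end

theorem proposition5p4:
  fixes small :: "'u set \<Rightarrow> bool" and code :: "'u set \<Rightarrow> 'u"
  assumes "small_universe small code"
  shows "right_adjoint (MV small) (sMV small) inclusion_functor (S_functor code)"
proof -
  interpret small_universe small code by fact
  \<comment> \<open>The bijection of hom-sets is precomposition with the unit.\<close>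
  let ?\<Phi> = "\<lambda>A B g. compose (carrier A) g (S_unit code A)"
  \<comment> \<open>Naturality in the first argument is naturality of the unit.\<close>
  have natural_left: "?\<Phi> A' B (compose (carrier (S_obj code A')) g (S_arr code A' A f)) =
      compose (carrier A') (?\<Phi> A B g) f"
    if "A \<in> Obj (MV small)" "A' \<in> Obj (MV small)" and f: "f \<in> mv_hom A' A" for A A' B :: "'u mv" and f g :: "'u \<Rightarrow> 'u"
  proof -
    interpret A: small_mv_algebra small code A using that by (intro MV_objD)
    interpret A': small_mv_algebra small code A' using that by (intro MV_objD)
    show ?thesis
      by (auto simp: compose_def fun_eq_iff A'.unit.closed mv_hom_closed[OF f]
          A'.S_arr_unit[OF A.mv_algebra_axioms f])
  qed
  \<comment> \<open>Naturality in the second argument is associativity, since the inclusion leaves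
    \<open>h\<close> unchanged.\<close>
  have natural_right: "?\<Phi> A B' (compose (carrier (S_obj code A)) h g) =
      compose (carrier A) h (?\<Phi> A B g)"
    if "A \<in> Obj (MV small)" for A B B' :: "'u mv" and g h :: "'u \<Rightarrow> 'u"
  proof -
    interpret A: small_mv_algebra small code A using that by (intro MV_objD)
    show ?thesis by (auto simp: compose_def fun_eq_iff A.unit.closed)
  qed
  show ?thesis
    unfolding right_adjoint_def
  proof (intro conjI exI[of _ ?\<Phi>])
    show "cat_functor (sMV small) (MV small) inclusion_functor"
      by (simp add: sMV_def inclusion_functor_full_subcategory category_MV)
  qed (use S_functor S_unit_bij natural_left natural_right in
      \<open>auto simp: S_functor_def inclusion_functor_def MV_simps sMV_simps\<close>)
qed

end
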